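(* Let $n\ge 1$ be an integer and let $\begin{bmatrix}A & B\\ B^* & C\end{bmatrix}\in\mathbb{M}_2(\mathbb{M}_n)$ be positive semidefinite. Then \[ 2\lVert\Phi(B)\rVert\le\lVert\Phi(A)+\Phi(C)\rVert \] and \[ 2\lVert\Psi(B)\rVert\le\lVert\Phi(A)+\Phi(C)\rVert \] for any unitarily invariant norm $\lVert\cdot\rVert$ on $\mathbb{M}_n$.
   Context: $\mathbb{M}_n$ is the space of $n\times n$ complex matrices, and $\mathbb{M}_2(\mathbb{M}_n)$ is the set of $2\times 2$ block matrices with blocks in $\mathbb{M}_n$, regarded also as $2n\times 2n$ complex matrices. For $X\in\mathbb{M}_n$, $\Phi(X)=(\mathrm{tr}\,X)I+X$ and $\Psi(X)=(\mathrm{tr}\,X)I-X$, where $I$ is the $n\times n$ identity matrix and $\mathrm{tr}$ is the usual trace. A norm $\lVert\cdot\rVert$ on $\mathbb{M}_n$ is unitarily invariant if $\lVert UXV\rVert=\lVert X\rVert$ for all $X\in\mathbb{M}_n$ and all unitary $U,V\in\mathbb{M}_n$. *)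

theory Defs
  imports "Jordan_Normal_Form.Schur_Decomposition"
begin

definition trace_mat :: "complex mat \<Rightarrow> complex" where
  "trace_mat X = (\<Sum>i<dim_row X. X $$ (i, i))"

definition Phi :: "complex mat \<Rightarrow> complex mat" where
  "Phi X = trace_mat X \<cdot>\<^sub>m 1\<^sub>m (dim_row X) + X"

definition Psi :: "complex mat \<Rightarrow> complex mat" where
  "Psi X = trace_mat X \<cdot>\<^sub>m 1\<^sub>m (dim_row X) - X"

text \<open>
  The Hermitian form is written \<open>(M *\<^sub>v v) \<bullet>c v\<close>, where \<open>\<bullet>c\<close> conjugates its
  second argument. For Hermitian \<open>M\<close> its value is real, so nothing is lost by taking \<open>Re\<close>.
\<close>
definition psd_mat :: "nat \<Rightarrow> complex mat \<Rightarrow> bool" where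
  "psd_mat m M \<longleftrightarrow> M \<in> carrier_mat m m \<and> mat_adjoint M = M \<and>
    (\<forall>v \<in> carrier_vec m. 0 \<le> Re ((M *\<^sub>v v) \<bullet>c v))"

definition unitary_mat :: "nat \<Rightarrow> complex mat \<Rightarrow> bool" where
  "unitary_mat n U \<longleftrightarrow> U \<in> carrier_mat n n \<and>
    mat_adjoint U * U = 1\<^sub>m n \<and> U * mat_adjoint U = 1\<^sub>m n"

text \<open>
  The type \<open>complex mat\<close> contains matrices of all sizes, so a norm on the \<open>n \<times> n\<close> matrices
  is a function constrained only on \<open>carrier_mat n n\<close>.
\<close>
definition norm_on_mat :: "nat \<Rightarrow> (complex mat \<Rightarrow> real) \<Rightarrow> bool" where
  "norm_on_mat n N \<longleftrightarrow>
    (\<forall>X \<in> carrier_mat n n. 0 \<le> N X \<and> (N X = 0 \<longleftrightarrow> X = 0\<^sub>m n n)) \<and>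
    (\<forall>c. \<forall>X \<in> carrier_mat n n. N (c \<cdot>\<^sub>m X) = cmod c * N X) \<and>
    (\<forall>X \<in> carrier_mat n n. \<forall>Y \<in> carrier_mat n n. N (X + Y) \<le> N X + N Y)"

definition unitarily_invariant_norm :: "nat \<Rightarrow> (complex mat \<Rightarrow> real) \<Rightarrow> bool" where
  "unitarily_invariant_norm n N \<longleftrightarrow> norm_on_mat n N \<and>
    (\<forall>X \<in> carrier_mat n n. \<forall>U V. unitary_mat n U \<longrightarrow> unitary_mat n V \<longrightarrow>
      N (U * X * V) = N X)"

end

theory Submission
  imports Defs "Jordan_Normal_Form.Spectral_Radius"
begin

text \<open>
  For positive \<open>[[A, B], [B\<^sup>*, C]]\<close> alone, \<open>2 \<parallel>B\<parallel> \<le> \<parallel>A + C\<parallel>\<close> may fail. It holds if the partial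
  transpose \<open>[[A, B\<^sup>*], [B, C]]\<close> is positive too. Let \<open>B = U P\<close> be a polar
  decomposition. The two positivity conditions, tested on vectors of the form \<open>(U z, -z)\<close> and
  \<open>(z, -U z)\<close> respectively, give \<open>U\<^sup>* A U + C \<ge> 2 P\<close> and \<open>U\<^sup>* C U + A \<ge> 2 P\<close>. Their sum is
  \<open>U\<^sup>* (A + C) U + (A + C) \<ge> 4 P\<close>, and a unitarily invariant norm is monotone on positive
  matrices, so \<open>4 \<parallel>B\<parallel> \<le> 2 \<parallel>A + C\<parallel>\<close>.

  The map \<open>\<Phi>\<close> is completely positive because \<open>X \<mapsto> (tr X) I\<close> is. Followed by transposition it
  becomes \<open>X \<mapsto> (tr X) I + X\<^sup>T\<close>, which is completely positive because its Choi matrix \<open>I + swap\<close> is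
  positive. So the image of the given block matrix under \<open>\<Phi>\<close> satisfies both positivity
  conditions. With \<open>\<Psi>(B)\<close> off the diagonal one uses \<open>I - swap\<close> for the second condition, and
  keeps \<open>\<Phi>(A)\<close> and \<open>\<Phi>(C)\<close> on the diagonal. What is needed of all this is one inequality between
  sesquilinear forms, \<open>Phi_Psi_form_le\<close>.

  In \<open>norm_le_of_form_le\<close> the polar decomposition is replaced by the singular value decomposition
  \<open>singular_value_decomposition\<close>, which makes the matrix on the left diagonal. Monotonicity of the norm
  then has to be known only in a weak form, \<open>norm_real_diag_le\<close>: a diagonal matrix that is entrywise
  dominated by the diagonal of \<open>Y\<close> has at most the norm of \<open>Y\<close>. This follows by averaging over
  diagonal unitaries.
\<close>

section \<open>Adjoints and sesquilinear forms\<close>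

lemma dim_mat_adjoint [simp]:
  "dim_row (mat_adjoint A) = dim_col A" "dim_col (mat_adjoint A) = dim_row A"
  by (simp_all add: mat_adjoint_def)

lemma index_mat_adjoint [simp]:
  "i < dim_col A \<Longrightarrow> j < dim_row A \<Longrightarrow> mat_adjoint A $$ (i, j) = conjugate (A $$ (j, i))"
  by (simp add: mat_adjoint_def mat_of_rows_index)

lemma mat_adjoint_carrier [simp]:
  "A \<in> carrier_mat m n \<Longrightarrow> mat_adjoint A \<in> carrier_mat n m"
  by auto

lemma index_mult_mat_sum:
  assumes "A \<in> carrier_mat m n" and "B \<in> carrier_mat n p" and "i < m" and "j < p"
  shows "(A * B) $$ (i, j) = (\<Sum>k<n. A $$ (i, k) * B $$ (k, j))"
  using assms by (simp add: scalar_prod_def lessThan_atLeast0)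

text \<open>
  The form \<open>x\<^sup>* A y\<close>. Vectors are functions on the indices, so that the test
  vectors below can be written down entrywise and all identities become manipulations of
  double sums.
\<close>
definition sesq :: "nat \<Rightarrow> complex mat \<Rightarrow> (nat \<Rightarrow> complex) \<Rightarrow> (nat \<Rightarrow> complex) \<Rightarrow> complex" where
  "sesq n A x y = (\<Sum>i<n. \<Sum>j<n. cnj (x i) * A $$ (i, j) * y j)"

definition ip :: "nat \<Rightarrow> (nat \<Rightarrow> complex) \<Rightarrow> (nat \<Rightarrow> complex) \<Rightarrow> complex" where
  "ip n x y = (\<Sum>i<n. cnj (x i) * y i)"

lemma sesq_uminus [simp]:
  "sesq n A (\<lambda>i. - x i) y = - sesq n A x y"
  "sesq n A x (\<lambda>i. - y i) = - sesq n A x y"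
  by (simp_all add: sesq_def sum_negf)

lemma ip_uminus [simp]:
  "ip n (\<lambda>i. - x i) y = - ip n x y"
  "ip n x (\<lambda>i. - y i) = - ip n x y"
  by (simp_all add: ip_def sum_negf)

lemma sesq_add_left: "sesq n A (\<lambda>i. x i + x' i) y = sesq n A x y + sesq n A x' y"
  by (simp add: sesq_def algebra_simps sum.distrib)

lemma sesq_add_right: "sesq n A x (\<lambda>i. y i + y' i) = sesq n A x y + sesq n A x y'"
  by (simp add: sesq_def algebra_simps sum.distrib)

lemma sesq_zero [simp]: "sesq n A (\<lambda>i. 0) y = 0" "sesq n A x (\<lambda>i. 0) = 0"
  by (simp_all add: sesq_def)

lemma sesq_delta:
  assumes "j < n" and "k < n"
  shows "sesq n A (\<lambda>i. if i = j then a else 0) (\<lambda>i. if i = k then b else 0) =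
    cnj a * A $$ (j, k) * b"
proof -
  have "sesq n A (\<lambda>i. if i = j then a else 0) (\<lambda>i. if i = k then b else 0) =
      (\<Sum>i<n. if i = j then \<Sum>l<n. if l = k then cnj a * A $$ (j, k) * b else 0 else 0)"
    unfolding sesq_def using assms
    by (intro sum.cong refl) (auto simp: if_distrib[of "\<lambda>z. _ * z"] cong: if_cong)
  then show ?thesis
    using assms by simp
qed

lemma sesq_add_mat:
  assumes "A \<in> carrier_mat n n" and "B \<in> carrier_mat n n"
  shows "sesq n (A + B) x y = sesq n A x y + sesq n B x y"
  using assms by (simp add: sesq_def algebra_simps sum.distrib)

lemma sesq_scalar_one:
  "sesq n (c \<cdot>\<^sub>m 1\<^sub>m n) x y = c * ip n x y"
proof -
  have "sesq n (c \<cdot>\<^sub>m 1\<^sub>m n) x y = (\<Sum>i<n. \<Sum>j<n. if j = i then c * (cnj (x i) * y i) else 0)"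
    unfolding sesq_def by (intro sum.cong refl) auto
  then show ?thesis
    by (simp add: ip_def sum_distrib_left)
qed

lemma Phi_carrier [simp]: "A \<in> carrier_mat n n \<Longrightarrow> Phi A \<in> carrier_mat n n"
  and Psi_carrier [simp]: "A \<in> carrier_mat n n \<Longrightarrow> Psi A \<in> carrier_mat n n"
  by (auto simp: Phi_def Psi_def)

lemma sesq_Phi:
  assumes "A \<in> carrier_mat n n"
  shows "sesq n (Phi A) x y = trace_mat A * ip n x y + sesq n A x y"
  using assms by (simp add: Phi_def sesq_add_mat sesq_scalar_one)

lemma sesq_Psi:
  assumes "A \<in> carrier_mat n n"
  shows "sesq n (Psi A) x y = trace_mat A * ip n x y - sesq n A x y"
proof -
  have "sesq n (Psi A) x y = sesq n (trace_mat A \<cdot>\<^sub>m 1\<^sub>m n) x y - sesq n A x y"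
    using assms by (simp add: Psi_def sesq_def algebra_simps sum_subtractf)
  then show ?thesis
    by (simp add: sesq_scalar_one)
qed

lemma sesq_vec:
  assumes "A \<in> carrier_mat n n"
  shows "(A *\<^sub>v vec n y) \<bullet>c vec n x = sesq n A x y"
  using assms
  by (simp add: sesq_def scalar_prod_def lessThan_atLeast0 sum_distrib_left sum_distrib_right ac_simps)

lemma sesq_adjoint:
  assumes "A \<in> carrier_mat n n"
  shows "sesq n (mat_adjoint A) x y = cnj (sesq n A y x)"
proof -
  have "sesq n (mat_adjoint A) x y = (\<Sum>i<n. \<Sum>j<n. cnj (x i) * cnj (A $$ (j, i)) * y j)"
    unfolding sesq_def using assms by (intro sum.cong refl) simp
  also have "\<dots> = cnj (sesq n A y x)"
    unfolding sesq_def by (subst sum.swap) (simp add: ac_simps)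
  finally show ?thesis .
qed

text \<open>
  This is positivity of the block matrix at the stacked vector \<open>(x, y)\<close>; the two off-diagonal
  blocks contribute complex conjugate numbers. Every positivity statement below is a sum of instances of
  this one.
\<close>
lemma psd_block_form:
  assumes A: "A \<in> carrier_mat n n" and B: "B \<in> carrier_mat n n" and C: "C \<in> carrier_mat n n"
    and psd: "psd_mat (2 * n) (four_block_mat A B (mat_adjoint B) C)"
  shows "0 \<le> Re (sesq n A x x) + Re (sesq n C y y) + 2 * Re (sesq n B x y)"
proof -
  let ?M = "four_block_mat A B (mat_adjoint B) C"
  let ?x = "vec n x" and ?y = "vec n y"
  have B': "mat_adjoint B \<in> carrier_mat n n"
    using B by simp
  have "?M *\<^sub>v (?x @\<^sub>v ?y) = (A *\<^sub>v ?x + B *\<^sub>v ?y) @\<^sub>v (mat_adjoint B *\<^sub>v ?x + C *\<^sub>v ?y)"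
    by (rule four_block_mat_mult_vec[OF A B B' C]) auto
  moreover have "conjugate (?x @\<^sub>v ?y) = conjugate ?x @\<^sub>v conjugate ?y"
    by (intro eq_vecI) auto
  ultimately have "(?M *\<^sub>v (?x @\<^sub>v ?y)) \<bullet>c (?x @\<^sub>v ?y) =
      (A *\<^sub>v ?x + B *\<^sub>v ?y) \<bullet>c ?x + (mat_adjoint B *\<^sub>v ?x + C *\<^sub>v ?y) \<bullet>c ?y"
    using A B B' C by (simp only:, subst scalar_prod_append[of _ n _ n])
      (auto intro!: add_carrier_vec mult_mat_vec_carrier[of _ n n])
  also have "\<dots> = (A *\<^sub>v ?x) \<bullet>c ?x + (B *\<^sub>v ?y) \<bullet>c ?x +
      ((mat_adjoint B *\<^sub>v ?x) \<bullet>c ?y + (C *\<^sub>v ?y) \<bullet>c ?y)"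
    by (simp only: add_scalar_prod_distrib[of _ n] mult_mat_vec_carrier[OF A]
        mult_mat_vec_carrier[OF B] mult_mat_vec_carrier[OF B'] mult_mat_vec_carrier[OF C]
        vec_carrier carrier_vec_conjugate)
  also have "\<dots> = sesq n A x x + sesq n B x y + (cnj (sesq n B x y) + sesq n C y y)"
    using A B C by (simp add: sesq_vec[OF A] sesq_vec[OF B] sesq_vec[OF C] sesq_vec[OF B'] sesq_adjoint[OF B])
  finally have "(?M *\<^sub>v (?x @\<^sub>v ?y)) \<bullet>c (?x @\<^sub>v ?y) =
      sesq n A x x + sesq n B x y + (cnj (sesq n B x y) + sesq n C y y)" .
  moreover have "?x @\<^sub>v ?y \<in> carrier_vec (2 * n)"
    by (simp add: mult_2)
  ultimately show ?thesis
    using psd unfolding psd_mat_def by fastforce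
qed

section \<open>Positivity of the block maps\<close>

text \<open>
  Here \<open>X \<mapsto> (tr X) I\<close> is written as a sum of compressions of \<open>X\<close>, with Kraus operators
  \<open>e\<^sub>j e\<^sub>k\<^sup>*\<close>: the test vectors are \<open>x\<^sub>k e\<^sub>j\<close>.
\<close>
lemma sesq_trace_sum:
  assumes "A \<in> carrier_mat n n"
  shows "(\<Sum>k<n. \<Sum>j<n. sesq n A (\<lambda>i. if i = j then x k else 0) (\<lambda>i. if i = j then y k else 0)) =
    trace_mat A * ip n x y"
proof -
  have "(\<Sum>k<n. \<Sum>j<n. sesq n A (\<lambda>i. if i = j then x k else 0) (\<lambda>i. if i = j then y k else 0)) =
      (\<Sum>k<n. \<Sum>j<n. A $$ (j, j) * (cnj (x k) * y k))"
    by (intro sum.cong refl) (simp add: sesq_delta)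
  also have "\<dots> = (\<Sum>j<n. \<Sum>k<n. A $$ (j, j) * (cnj (x k) * y k))"
    by (rule sum.swap)
  finally show ?thesis
    using assms by (simp add: trace_mat_def ip_def sum_product)
qed

text \<open>
  The maps \<open>X \<mapsto> (tr X) I + s X\<^sup>T\<close> with \<open>s = \<plusminus>1\<close> are completely positive, because their Choi
  matrices \<open>I \<plusminus> swap\<close> are positive. In coordinates their Kraus operators come from the symmetric
  or antisymmetric vectors \<open>u\<^sub>k e\<^sub>j + s u\<^sub>j e\<^sub>k\<close>. Taking \<open>u\<close> to be the conjugate of the given
  vector undoes the transposition, which is why \<open>x\<close> and \<open>y\<close> trade places on the right-hand side.
\<close>
lemma sesq_swap_sum:
  assumes A: "A \<in> carrier_mat n n" and s: "s = 1 \<or> s = - 1"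
  shows "(\<Sum>k<n. \<Sum>j<n. sesq n A
      (\<lambda>i. (if i = j then cnj (x k) else 0) + (if i = k then s * cnj (x j) else 0))
      (\<lambda>i. (if i = j then cnj (y k) else 0) + (if i = k then s * cnj (y j) else 0))) =
    2 * (trace_mat A * ip n y x + s * sesq n A y x)"
proof -
  have ss: "cnj s = s" "s * s = 1"
    using s by auto
  let ?t = "\<lambda>j k. A $$ (j, j) * (cnj (y k) * x k)"
  let ?q = "\<lambda>j k. cnj (y j) * A $$ (j, k) * x k"
  have t: "(\<Sum>j<n. \<Sum>k<n. ?t j k) = trace_mat A * ip n y x"
    using A by (simp add: trace_mat_def ip_def sum_product)
  have expand: "sesq n A
      (\<lambda>i. (if i = j then cnj (x k) else 0) + (if i = k then s * cnj (x j) else 0))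
      (\<lambda>i. (if i = j then cnj (y k) else 0) + (if i = k then s * cnj (y j) else 0)) =
      ?t j k + ?t k j + s * (?q j k + ?q k j)" if "j < n" "k < n" for j k
  proof -
    have "s * cnj s = 1"
      using ss by simp
    then have "(s * x j) * A $$ (k, k) * (s * cnj (y j)) = ?t k j"
      using ss by (metis (no_types, lifting) mult.assoc mult.left_commute mult.commute mult_1)
    then show ?thesis
      using that ss by (simp add: sesq_add_left sesq_add_right sesq_delta algebra_simps)
  qed
  have "(\<Sum>k<n. \<Sum>j<n. sesq n A
      (\<lambda>i. (if i = j then cnj (x k) else 0) + (if i = k then s * cnj (x j) else 0))
      (\<lambda>i. (if i = j then cnj (y k) else 0) + (if i = k then s * cnj (y j) else 0))) =
      (\<Sum>k<n. \<Sum>j<n. ?t j k + ?t k j + s * (?q j k + ?q k j))"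
    by (intro sum.cong refl) (simp add: expand)
  also have "\<dots> = (\<Sum>k<n. \<Sum>j<n. ?t j k) + (\<Sum>k<n. \<Sum>j<n. ?t k j)
      + s * ((\<Sum>k<n. \<Sum>j<n. ?q j k) + (\<Sum>k<n. \<Sum>j<n. ?q k j))"
    by (simp only: sum.distrib distrib_left sum_distrib_left)
  also have "(\<Sum>k<n. \<Sum>j<n. ?t j k) = (\<Sum>j<n. \<Sum>k<n. ?t j k)"
    by (rule sum.swap)
  also have "(\<Sum>k<n. \<Sum>j<n. ?q j k) = (\<Sum>j<n. \<Sum>k<n. ?q j k)"
    by (rule sum.swap)
  finally show ?thesis
    unfolding t sesq_def[symmetric] by (simp add: algebra_simps)
qed

text \<open>
  Summing positivity of the block matrix over the test vectors \<open>(x\<^sub>k e\<^sub>j, y\<^sub>k e\<^sub>j)\<close> shows that the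
  block matrix of the multiples of \<open>I\<close> by the traces is again positive.
\<close>
lemma psd_block_trace_form:
  assumes carr: "A \<in> carrier_mat n n" "B \<in> carrier_mat n n" "C \<in> carrier_mat n n"
    and psd: "psd_mat (2 * n) (four_block_mat A B (mat_adjoint B) C)"
  shows "0 \<le> Re (trace_mat A * ip n x x) + Re (trace_mat C * ip n y y) + 2 * Re (trace_mat B * ip n x y)"
proof -
  let ?d = "\<lambda>j (a::complex) i. if i = j then a else 0"
  have "0 \<le> (\<Sum>k<n. \<Sum>j<n. Re (sesq n A (?d j (x k)) (?d j (x k))) +
      Re (sesq n C (?d j (y k)) (?d j (y k))) + 2 * Re (sesq n B (?d j (x k)) (?d j (y k))))"
    by (intro sum_nonneg psd_block_form[OF carr psd])
  also have "\<dots> = Re (\<Sum>k<n. \<Sum>j<n. sesq n A (?d j (x k)) (?d j (x k))) +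
      Re (\<Sum>k<n. \<Sum>j<n. sesq n C (?d j (y k)) (?d j (y k))) +
      2 * Re (\<Sum>k<n. \<Sum>j<n. sesq n B (?d j (x k)) (?d j (y k)))"
    by (simp only: sum.distrib sum_distrib_left Re_sum)
  finally show ?thesis
    by (simp only: sesq_trace_sum carr)
qed

text \<open>
  The same with the test vectors of \<open>sesq_swap_sum\<close>. Note the places of \<open>x\<close> and \<open>y\<close>: since the
  underlying map involves a transposition, \<open>B\<close> is paired as before whereas \<open>A\<close> and \<open>C\<close> have
  exchanged their roles. This is the form of the partially transposed block matrix.
\<close>
lemma psd_block_swap_form:
  assumes carr: "A \<in> carrier_mat n n" "B \<in> carrier_mat n n" "C \<in> carrier_mat n n"
    and psd: "psd_mat (2 * n) (four_block_mat A B (mat_adjoint B) C)"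
    and s: "s = 1 \<or> s = - 1"
  shows "0 \<le> Re (trace_mat A * ip n y y + s * sesq n A y y) +
    Re (trace_mat C * ip n x x + s * sesq n C x x) + 2 * Re (trace_mat B * ip n x y + s * sesq n B x y)"
proof -
  let ?d = "\<lambda>x j k i. (if i = j then cnj (x k) else 0) + (if i = k then s * cnj (x j) else 0)"
  have "0 \<le> (\<Sum>k<n. \<Sum>j<n. Re (sesq n A (?d y j k) (?d y j k)) +
      Re (sesq n C (?d x j k) (?d x j k)) + 2 * Re (sesq n B (?d y j k) (?d x j k)))"
    by (intro sum_nonneg psd_block_form[OF carr psd])
  also have "\<dots> = Re (\<Sum>k<n. \<Sum>j<n. sesq n A (?d y j k) (?d y j k)) +
      Re (\<Sum>k<n. \<Sum>j<n. sesq n C (?d x j k) (?d x j k)) +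
      2 * Re (\<Sum>k<n. \<Sum>j<n. sesq n B (?d y j k) (?d x j k))"
    by (simp only: sum.distrib sum_distrib_left Re_sum)
  finally show ?thesis
    unfolding sesq_swap_sum[OF carr(1) s] sesq_swap_sum[OF carr(2) s] sesq_swap_sum[OF carr(3) s]
    by simp
qed

text \<open>
  Each of \<open>\<Phi>(B)\<close> and \<open>\<Psi>(B)\<close> is dominated twice, once with \<open>x\<close> paired to \<open>A\<close> and \<open>y\<close> to \<open>C\<close>, and
  once the other way round; adding the two bounds makes the right-hand side depend on
  \<open>\<Phi>(A) + \<Phi>(C)\<close> only.

  For \<open>\<Phi>\<close> the first bound is the trace form plus the original form, and the second is the
  swap form with \<open>s = 1\<close>, all at \<open>(x, -y)\<close>. For \<open>\<Psi>\<close> the first bound takes the original form at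
  \<open>(x, y)\<close> instead, to turn the sign of \<open>B\<close>, and the second takes \<open>s = -1\<close>; that one bounds by
  \<open>\<Psi>(A)\<close> and \<open>\<Psi>(C)\<close>, and \<open>\<Psi>(A) \<le> \<Phi>(A)\<close> because \<open>A\<close> is positive.
\<close>
lemma Phi_Psi_form_le:
  assumes carr: "A \<in> carrier_mat n n" "B \<in> carrier_mat n n" "C \<in> carrier_mat n n"
    and psd: "psd_mat (2 * n) (four_block_mat A B (mat_adjoint B) C)"
  shows "4 * Re (sesq n (Phi B) x y) \<le>
      Re (sesq n (Phi A + Phi C) x x) + Re (sesq n (Phi A + Phi C) y y)"
    and "4 * Re (sesq n (Psi B) x y) \<le>
      Re (sesq n (Phi A + Phi C) x x) + Re (sesq n (Phi A + Phi C) y y)"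
proof -
  have S: "sesq n (Phi A + Phi C) z z =
      trace_mat A * ip n z z + sesq n A z z + (trace_mat C * ip n z z + sesq n C z z)" for z
    using carr by (simp add: sesq_add_mat sesq_Phi)
  note tr = psd_block_trace_form[OF carr psd, of x "\<lambda>i. - y i"]
  note swap_plus = psd_block_swap_form[OF carr psd, of 1 "\<lambda>i. - y i" x]
  note swap_minus = psd_block_swap_form[OF carr psd, of "-1" "\<lambda>i. - y i" x]
  show "4 * Re (sesq n (Phi B) x y) \<le>
      Re (sesq n (Phi A + Phi C) x x) + Re (sesq n (Phi A + Phi C) y y)"
    using tr swap_plus psd_block_form[OF carr psd, of x "\<lambda>i. - y i"]
    by (simp add: S sesq_Phi[OF carr(2)])
  have "0 \<le> Re (sesq n A y y)"
    using psd_block_form[OF carr psd, of y "\<lambda>i. 0"] by simp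
  moreover have "0 \<le> Re (sesq n C x x)"
    using psd_block_form[OF carr psd, of "\<lambda>i. 0" x] by simp
  ultimately show "4 * Re (sesq n (Psi B) x y) \<le>
      Re (sesq n (Phi A + Phi C) x x) + Re (sesq n (Phi A + Phi C) y y)"
    using tr swap_minus psd_block_form[OF carr psd, of x y]
    by (simp add: S sesq_Psi[OF carr(2)])
qed

section \<open>Unitary matrices\<close>

lemma unitary_matI:
  assumes U: "U \<in> carrier_mat n n" and "mat_adjoint U * U = 1\<^sub>m n"
  shows "unitary_mat n U"
  using assms mat_mult_left_right_inverse[OF mat_adjoint_carrier[OF U] U]
  by (simp add: unitary_mat_def)

lemma mat_adjoint_mult:
  fixes A B :: "complex mat"
  assumes "A \<in> carrier_mat m n" and "B \<in> carrier_mat n p"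
  shows "mat_adjoint (A * B) = mat_adjoint B * mat_adjoint A"
  using assms by (intro eq_matI) (auto simp: scalar_prod_def ac_simps)

lemma mat_adjoint_adjoint [simp]: "mat_adjoint (mat_adjoint A) = A"
  by (intro eq_matI) auto

lemma unitary_mat_adjoint: "unitary_mat n U \<Longrightarrow> unitary_mat n (mat_adjoint U)"
  by (simp add: unitary_mat_def)

lemma unitary_mat_mult:
  assumes "unitary_mat n U" and "unitary_mat n V"
  shows "unitary_mat n (U * V)"
proof (rule unitary_matI)
  have U: "U \<in> carrier_mat n n" "mat_adjoint U \<in> carrier_mat n n"
    and V: "V \<in> carrier_mat n n" "mat_adjoint V \<in> carrier_mat n n"
    and UU: "mat_adjoint U * U = 1\<^sub>m n" and VV: "mat_adjoint V * V = 1\<^sub>m n"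
    using assms by (auto simp: unitary_mat_def)
  show "U * V \<in> carrier_mat n n"
    using U V by simp
  have "mat_adjoint (U * V) * (U * V) = mat_adjoint V * (mat_adjoint U * U * V)"
    using U V by (simp add: mat_adjoint_mult[OF U(1) V(1)] assoc_mult_mat[of _ n n _ n _ n])
  then show "mat_adjoint (U * V) * (U * V) = 1\<^sub>m n"
    using UU VV V by simp
qed

lemma unitary_mat_col_ip:
  assumes "unitary_mat n U" and "i < n" and "j < n"
  shows "(\<Sum>k<n. cnj (U $$ (k, i)) * U $$ (k, j)) = (if i = j then 1 else 0)"
proof -
  have U: "U \<in> carrier_mat n n" and "(mat_adjoint U * U) $$ (i, j) = 1\<^sub>m n $$ (i, j)"
    using assms(1) by (auto simp: unitary_mat_def)
  then show ?thesis
    using assms(2,3)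
    by (simp add: index_mult_mat_sum[OF mat_adjoint_carrier[OF U] U] index_mat_adjoint del: index_mult_mat)
qed

text \<open>
  Gram-Schmidt applied to a basis that starts with \<open>v\<close> keeps \<open>v\<close> as its first vector. It gives
  orthogonal but unnormalised columns, hence the division by their lengths \<open>r j\<close>.
\<close>
lemma unit_vec_extends_to_unitary:
  fixes v :: "complex vec"
  assumes v: "v \<in> carrier_vec n" and unit: "v \<bullet>c v = 1"
  obtains U where "unitary_mat n U" and "\<And>i. i < n \<Longrightarrow> U $$ (i, 0) = v $ i"
proof -
  interpret cof_vec_space n "TYPE(complex)" .
  have v0: "v \<noteq> 0\<^sub>v n"
    using unit v by auto
  define b where "b = basis_completion v"
  define ws where "ws = gram_schmidt n b"
  note basis = basis_completion[OF v v0, folded b_def]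
  have ws: "set ws \<subseteq> carrier_vec n" "corthogonal ws" "length ws = n"
    using gram_schmidt_result[OF basis(2,4,5) ws_def] basis(6) by auto
  have "b \<noteq> []"
    using basis(6) v v0 by auto
  then obtain bs where "b = v # bs"
    using basis(7) by (cases b) auto
  then have hd_ws: "hd ws = v"
    using gram_schmidt_hd[OF v] by (simp add: ws_def)
  have n: "n > 0"
    using v v0 by (cases n) auto
  then have ws0: "ws ! 0 = v"
    using hd_ws ws(3) by (cases ws) auto
  define r where "r j = sqrt (Re (ws ! j \<bullet>c ws ! j))" for j
  have carr: "ws ! j \<in> carrier_vec n" if "j < n" for j
    using that ws by (metis nth_mem subsetD)
  have r: "r j \<noteq> 0" "ws ! j \<bullet>c ws ! j = of_real (r j * r j)" if "j < n" for j
  proof -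
    have "ws ! j \<bullet>c ws ! j \<noteq> 0"
      using corthogonalD[OF ws(2), of j j] that ws(3) by simp
    then have "ws ! j \<bullet>c ws ! j > 0"
      using carr[OF that] conjugate_square_greater_0_vec conjugate_square_eq_0_vec by blast
    then show "r j \<noteq> 0" "ws ! j \<bullet>c ws ! j = of_real (r j * r j)"
      by (auto simp: r_def less_complex_def complex_eq_iff)
  qed
  define U where "U = mat n n (\<lambda>(i, j). ws ! j $ i / of_real (r j))"
  have U: "U \<in> carrier_mat n n"
    by (simp add: U_def)
  have "mat_adjoint U * U = 1\<^sub>m n"
  proof (rule eq_matI)
    show "dim_row (mat_adjoint U * U) = dim_row (1\<^sub>m n)" "dim_col (mat_adjoint U * U) = dim_col (1\<^sub>m n)"
      using mat_adjoint_carrier[OF U] U by auto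
    fix i j
    assume "i < dim_row (1\<^sub>m n :: complex mat)" and "j < dim_col (1\<^sub>m n :: complex mat)"
    then have ij: "i < n" "j < n"
      by auto
    have "(mat_adjoint U * U) $$ (i, j) = (\<Sum>k<n. cnj (U $$ (k, i)) * U $$ (k, j))"
      using ij U by (simp add: index_mult_mat_sum[OF mat_adjoint_carrier[OF U] U] index_mat_adjoint del: index_mult_mat)
    also have "\<dots> = (\<Sum>k<n. ws ! j $ k * cnj (ws ! i $ k) / of_real (r i * r j))"
      using ij by (intro sum.cong refl) (simp add: U_def)
    also have "\<dots> = (ws ! j \<bullet>c ws ! i) / of_real (r i * r j)"
      using carr[OF ij(1)] by (simp add: scalar_prod_def sum_divide_distrib lessThan_atLeast0)
    also have "\<dots> = 1\<^sub>m n $$ (i, j)"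
      using corthogonalD[OF ws(2), of j i] ij ws(3) r[of j] by (auto simp: index_one_mat)
    finally show "(mat_adjoint U * U) $$ (i, j) = 1\<^sub>m n $$ (i, j)" .
  qed
  then have "unitary_mat n U"
    by (rule unitary_matI[OF U])
  moreover have "U $$ (i, 0) = v $ i" if "i < n" for i
    using that n unit by (simp add: U_def r_def ws0)
  ultimately show ?thesis
    using that by blast
qed

section \<open>Singular value decomposition\<close>

lemma mat_adjoint_cscalar_prod:
  fixes A :: "complex mat"
  assumes A: "A \<in> carrier_mat n n" and v: "v \<in> carrier_vec n" and w: "w \<in> carrier_vec n"
  shows "(A *\<^sub>v v) \<bullet>c w = v \<bullet>c (mat_adjoint A *\<^sub>v w)"
proof -
  have "(A *\<^sub>v v) \<bullet>c w = (\<Sum>i<n. \<Sum>j<n. A $$ (i, j) * v $ j * cnj (w $ i))"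
    using assms by (simp add: scalar_prod_def sum_distrib_right lessThan_atLeast0)
  also have "\<dots> = (\<Sum>j<n. \<Sum>i<n. A $$ (i, j) * v $ j * cnj (w $ i))"
    by (rule sum.swap)
  also have "\<dots> = v \<bullet>c (mat_adjoint A *\<^sub>v w)"
    using assms
    by (simp add: scalar_prod_def sum_distrib_left lessThan_atLeast0 ac_simps)
  finally show ?thesis .
qed

lemma normalize_vec:
  fixes v :: "complex vec"
  assumes v: "v \<in> carrier_vec n" and v0: "v \<noteq> 0\<^sub>v n"
  obtains r :: real where "r > 0" and "v \<bullet>c v = of_real (r\<^sup>2)"
    and "(1 / of_real r \<cdot>\<^sub>v v) \<bullet>c (1 / of_real r \<cdot>\<^sub>v v) = 1"
proof -
  define r where "r = sqrt (Re (v \<bullet>c v))"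
  have "v \<bullet>c v > 0"
    using assms by simp
  then have r: "r > 0" "v \<bullet>c v = of_real (r\<^sup>2)"
    by (auto simp: r_def less_complex_def complex_eq_iff)
  have "(1 / of_real r \<cdot>\<^sub>v v) \<bullet>c (1 / of_real r \<cdot>\<^sub>v v) = 1 / of_real r * (1 / of_real r * (v \<bullet>c v))"
    using v by (simp add: conjugate_smult_vec)
  also have "\<dots> = 1"
    using r by (simp add: power2_eq_square)
  finally show ?thesis
    using that r by blast
qed

lemma det_mat_adjoint:
  assumes "A \<in> carrier_mat n n"
  shows "det (mat_adjoint A) = cnj (det A)"
proof -
  interpret comm_ring_hom cnj
    by unfold_locales auto
  have "mat_adjoint A = map_mat cnj (transpose_mat A)"
    by (intro eq_matI) auto
  then show ?thesis
    using assms by (simp add: hom_det det_transpose)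
qed

text \<open>
  Take a unit eigenvector \<open>v\<close> of \<open>B\<^sup>* B\<close>. If \<open>B v \<noteq> 0\<close>, its normalisation serves as \<open>w\<close>, and the
  eigenvalue is \<open>\<parallel>B v\<parallel>\<^sup>2\<close>. If \<open>B v = 0\<close>, then \<open>B\<close> is singular, so its adjoint is singular as well
  and a unit vector of the kernel of \<open>B\<^sup>*\<close> serves as \<open>w\<close> with \<open>s = 0\<close>.
\<close>
lemma singular_pair_exists:
  fixes B :: "complex mat"
  assumes B: "B \<in> carrier_mat n n" and n: "n > 0"
  obtains s :: real and v w where "s \<ge> 0" and "v \<in> carrier_vec n" and "v \<bullet>c v = 1"
    and "w \<in> carrier_vec n" and "w \<bullet>c w = 1"
    and "B *\<^sub>v v = of_real s \<cdot>\<^sub>v w" and "mat_adjoint B *\<^sub>v w = of_real s \<cdot>\<^sub>v v"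
proof -
  note B' = mat_adjoint_carrier[OF B]
  have BB: "mat_adjoint B * B \<in> carrier_mat n n"
    using B B' by (rule mult_carrier_mat[rotated])
  obtain l u where u: "u \<in> carrier_vec n" "u \<noteq> 0\<^sub>v n" "mat_adjoint B * B *\<^sub>v u = l \<cdot>\<^sub>v u"
    using spectrum_non_empty[OF BB n] BB unfolding spectrum_def eigenvalue_def eigenvector_def by auto
  obtain r where r: "r > 0" "(1 / complex_of_real r \<cdot>\<^sub>v u) \<bullet>c (1 / of_real r \<cdot>\<^sub>v u) = 1"
    using normalize_vec[OF u(1,2)] by blast
  define v where "v = 1 / complex_of_real r \<cdot>\<^sub>v u"
  have v: "v \<in> carrier_vec n" "v \<bullet>c v = 1"
    using u r by (auto simp: v_def)
  have Bv: "B *\<^sub>v v \<in> carrier_vec n"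
    using B v by simp
  have "mat_adjoint B * B *\<^sub>v v = l \<cdot>\<^sub>v v"
    unfolding v_def using u BB
    by (simp add: mult_mat_vec[OF BB u(1)] smult_smult_assoc mult.commute del: assoc_mult_mat_vec)
  then have ev: "mat_adjoint B *\<^sub>v (B *\<^sub>v v) = l \<cdot>\<^sub>v v"
    using B B' v by simp
  show ?thesis
  proof (cases "B *\<^sub>v v = 0\<^sub>v n")
    case True
    have "v \<noteq> 0\<^sub>v n"
      using v by auto
    then have "det B = 0"
      using True v det_0_iff_vec_prod_zero[OF B] by blast
    then have "det (mat_adjoint B) = 0"
      by (simp add: det_mat_adjoint[OF B])
    then obtain y where y: "y \<in> carrier_vec n" "y \<noteq> 0\<^sub>v n" "mat_adjoint B *\<^sub>v y = 0\<^sub>v n"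
      using det_0_iff_vec_prod_zero[OF B'] by blast
    obtain q where q: "q > 0" "(1 / complex_of_real q \<cdot>\<^sub>v y) \<bullet>c (1 / of_real q \<cdot>\<^sub>v y) = 1"
      using normalize_vec[OF y(1,2)] by blast
    define w where "w = 1 / complex_of_real q \<cdot>\<^sub>v y"
    have w: "w \<in> carrier_vec n" "w \<bullet>c w = 1" "mat_adjoint B *\<^sub>v w = 0\<^sub>v n"
      using y q by (auto simp: w_def mult_mat_vec[OF B' y(1)])
    have "0 \<cdot>\<^sub>v v = 0\<^sub>v n" "0 \<cdot>\<^sub>v w = 0\<^sub>v n"
      using v w by auto
    then show ?thesis
      using that[of 0 v w] v w True by simp
  next
    case False
    obtain q where q: "q > 0" "(B *\<^sub>v v) \<bullet>c (B *\<^sub>v v) = of_real (q\<^sup>2)"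
      "(1 / complex_of_real q \<cdot>\<^sub>v (B *\<^sub>v v)) \<bullet>c (1 / of_real q \<cdot>\<^sub>v (B *\<^sub>v v)) = 1"
      using normalize_vec[OF Bv False] by blast
    have "of_real (q\<^sup>2) = v \<bullet>c (l \<cdot>\<^sub>v v)"
      using q(2) mat_adjoint_cscalar_prod[OF B v(1) Bv] ev by simp
    also have "\<dots> = cnj l"
      using v by (simp add: conjugate_smult_vec)
    finally have l: "l = of_real (q\<^sup>2)"
      by (metis complex_cnj_cnj complex_cnj_complex_of_real)
    define w where "w = 1 / complex_of_real q \<cdot>\<^sub>v (B *\<^sub>v v)"
    have w: "w \<in> carrier_vec n" "w \<bullet>c w = 1" "B *\<^sub>v v = of_real q \<cdot>\<^sub>v w"
      using Bv q by (auto simp: w_def smult_smult_assoc)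
    have "mat_adjoint B *\<^sub>v w = (1 / of_real q * l) \<cdot>\<^sub>v v"
      using ev by (simp add: w_def mult_mat_vec[OF B' Bv] smult_smult_assoc)
    then have "mat_adjoint B *\<^sub>v w = of_real q \<cdot>\<^sub>v v"
      using q(1) by (simp add: l power2_eq_square)
    then show ?thesis
      using that[of q v w] q(1) v w by simp
  qed
qed

lemma mult_block_diag:
  assumes "A \<in> carrier_mat m m" and "A' \<in> carrier_mat m m"
    and "D \<in> carrier_mat n n" and "D' \<in> carrier_mat n n"
  shows "four_block_mat A (0\<^sub>m m n) (0\<^sub>m n m) D * four_block_mat A' (0\<^sub>m m n) (0\<^sub>m n m) D' =
    four_block_mat (A * A') (0\<^sub>m m n) (0\<^sub>m n m) (D * D')"
  using assms by (subst mult_four_block_mat[of _ m m _ n _ n _ _ m _ n]) auto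

lemma mat_adjoint_block_diag:
  fixes A D :: "complex mat"
  assumes "A \<in> carrier_mat m m" and "D \<in> carrier_mat n n"
  shows "mat_adjoint (four_block_mat A (0\<^sub>m m n) (0\<^sub>m n m) D) =
    four_block_mat (mat_adjoint A) (0\<^sub>m m n) (0\<^sub>m n m) (mat_adjoint D)"
  using assms by (intro eq_matI) auto

lemma mat_adjoint_one [simp]: "mat_adjoint (1\<^sub>m n :: complex mat) = 1\<^sub>m n"
  by (intro eq_matI) auto

lemma unitary_block_diag:
  assumes "unitary_mat n U"
  shows "unitary_mat (Suc n) (four_block_mat (1\<^sub>m 1) (0\<^sub>m 1 n) (0\<^sub>m n 1) U)"
proof (rule unitary_matI)
  have U: "U \<in> carrier_mat n n" "mat_adjoint U * U = 1\<^sub>m n"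
    using assms by (auto simp: unitary_mat_def)
  show "four_block_mat (1\<^sub>m 1) (0\<^sub>m 1 n) (0\<^sub>m n 1) U \<in> carrier_mat (Suc n) (Suc n)"
    using four_block_carrier_mat[of "1\<^sub>m 1" 1 1 U n n] U by simp
  show "mat_adjoint (four_block_mat (1\<^sub>m 1) (0\<^sub>m 1 n) (0\<^sub>m n 1) U) *
      four_block_mat (1\<^sub>m 1) (0\<^sub>m 1 n) (0\<^sub>m n 1) U = 1\<^sub>m (Suc n)"
    using U by (simp add: mat_adjoint_block_diag mult_block_diag)
qed

definition real_diag :: "nat \<Rightarrow> (nat \<Rightarrow> real) \<Rightarrow> complex mat" where
  "real_diag n d = mat n n (\<lambda>(i, j). if i = j then complex_of_real (d i) else 0)"

text \<open>
  By induction on the size. A singular pair \<open>(v, w)\<close>, completed to unitary matrices \<open>V\<close> and \<open>W\<close>,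
  splits \<open>W\<^sup>* B V\<close> into the singular value and a smaller block: \<open>B v = s w\<close> clears the first
  column and \<open>B\<^sup>* w = s v\<close> the first row.
\<close>
lemma singular_value_decomposition:
  assumes "B \<in> carrier_mat n n"
  obtains U V d where "unitary_mat n U" and "unitary_mat n V" and "\<And>i. 0 \<le> d i"
    and "mat_adjoint U * B * V = real_diag n d"
  using assms
proof (induction n arbitrary: B thesis)
  case 0
  have "unitary_mat 0 (1\<^sub>m 0)"
    by (simp add: unitary_mat_def)
  then show ?case
    using 0(2) by (intro 0(1)[of "1\<^sub>m 0" "1\<^sub>m 0" "\<lambda>_. 0"]) (auto simp: real_diag_def)
next
  case (Suc n)
  note B = Suc.prems(2)
  obtain s v w where s: "s \<ge> 0" and v: "v \<in> carrier_vec (Suc n)" "v \<bullet>c v = 1"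
    and w: "w \<in> carrier_vec (Suc n)" "w \<bullet>c w = 1"
    and Bv: "B *\<^sub>v v = of_real s \<cdot>\<^sub>v w" and Bw: "mat_adjoint B *\<^sub>v w = of_real s \<cdot>\<^sub>v v"
    using singular_pair_exists[OF B] by blast
  obtain V where V: "unitary_mat (Suc n) V" "\<And>i. i < Suc n \<Longrightarrow> V $$ (i, 0) = v $ i"
    using unit_vec_extends_to_unitary[OF v] by blast
  obtain W where W: "unitary_mat (Suc n) W" "\<And>i. i < Suc n \<Longrightarrow> W $$ (i, 0) = w $ i"
    using unit_vec_extends_to_unitary[OF w] by blast
  have carr: "V \<in> carrier_mat (Suc n) (Suc n)" "W \<in> carrier_mat (Suc n) (Suc n)"
    "mat_adjoint W \<in> carrier_mat (Suc n) (Suc n)"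
    using V W by (auto simp: unitary_mat_def)
  define M where "M = mat_adjoint W * B * V"
  have M: "M \<in> carrier_mat (Suc n) (Suc n)"
    using carr B by (auto simp: M_def)
  have col0: "M $$ (i, 0) = (if i = 0 then of_real s else 0)" if i: "i < Suc n" for i
  proof -
    have "(B * V) $$ (k, 0) = of_real s * W $$ (k, 0)" if k: "k < Suc n" for k
    proof -
      have "(B * V) $$ (k, 0) = (B *\<^sub>v v) $ k"
        using k B carr v V(2) by (simp add: scalar_prod_def)
      then show ?thesis
        using k w W(2) by (simp add: Bv)
    qed
    then have "(mat_adjoint W * (B * V)) $$ (i, 0) =
        of_real s * (\<Sum>k<Suc n. cnj (W $$ (k, i)) * W $$ (k, 0))"
      using i B carr by (subst index_mult_mat_sum[of _ "Suc n" "Suc n" _ "Suc n"])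
        (auto simp: sum_distrib_left ac_simps simp del: sum.lessThan_Suc intro!: sum.cong)
    then show ?thesis
      using unitary_mat_col_ip[OF W(1) i, of 0] B carr
      by (simp add: M_def assoc_mult_mat[of _ "Suc n" "Suc n" _ "Suc n" _ "Suc n"])
  qed
  have row0: "M $$ (0, j) = (if j = 0 then of_real s else 0)" if j: "j < Suc n" for j
  proof -
    have "(mat_adjoint W * B) $$ (0, k) = of_real s * cnj (V $$ (k, 0))" if k: "k < Suc n" for k
    proof -
      have "(mat_adjoint W * B) $$ (0, k) = cnj ((mat_adjoint B *\<^sub>v w) $ k)"
        using k B carr w W(2) by (simp add: scalar_prod_def ac_simps)
      then show ?thesis
        using k v V(2) by (simp add: Bw)
    qed
    then have "M $$ (0, j) = of_real s * (\<Sum>k<Suc n. cnj (V $$ (k, 0)) * V $$ (k, j))"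
      unfolding M_def using j B carr mult_carrier_mat[OF carr(3) B] by (subst index_mult_mat_sum[of _ "Suc n" "Suc n" _ "Suc n"])
        (auto simp: sum_distrib_left ac_simps simp del: sum.lessThan_Suc index_mult_mat intro!: sum.cong)
    then show ?thesis
      using unitary_mat_col_ip[OF V(1) _ j, of 0] by simp
  qed
  define D where "D = mat n n (\<lambda>(i, j). M $$ (Suc i, Suc j))"
  have D: "D \<in> carrier_mat n n"
    by (simp add: D_def)
  let ?s = "mat 1 1 (\<lambda>_. complex_of_real s)"
  let ?block = "\<lambda>a X. four_block_mat a (0\<^sub>m 1 n) (0\<^sub>m n 1) X"
  have M_block: "M = ?block ?s D"
    using M by (intro eq_matI) (auto simp: D_def col0 row0)
  obtain P Q d where P: "unitary_mat n P" and Q: "unitary_mat n Q" and d: "\<And>i. 0 \<le> d i"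
    and PDQ: "mat_adjoint P * D * Q = real_diag n d"
    using Suc.IH[OF _ D] by blast
  have PQ: "P \<in> carrier_mat n n" "Q \<in> carrier_mat n n"
    using P Q by (auto simp: unitary_mat_def)
  let ?P = "?block (1\<^sub>m 1) P" and ?Q = "?block (1\<^sub>m 1) Q"
  have P': "unitary_mat (Suc n) ?P" and Q': "unitary_mat (Suc n) ?Q"
    using P Q unitary_block_diag by blast+
  have PQ': "?P \<in> carrier_mat (Suc n) (Suc n)" "?Q \<in> carrier_mat (Suc n) (Suc n)"
    "mat_adjoint ?P \<in> carrier_mat (Suc n) (Suc n)"
    using P' Q' unfolding unitary_mat_def by (blast intro: mat_adjoint_carrier)+
  have "mat_adjoint (W * ?P) * B * (V * ?Q) = mat_adjoint ?P * M * ?Q"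
    unfolding M_def mat_adjoint_mult[OF carr(2) PQ'(1)]
    using carr B PQ' by (simp only: assoc_mult_mat[of _ "Suc n" "Suc n" _ "Suc n" _ "Suc n"]
        mult_carrier_mat[of _ "Suc n" "Suc n"])
  also have "\<dots> = ?block (1\<^sub>m 1 * ?s * 1\<^sub>m 1) (mat_adjoint P * D * Q)"
    using PQ D by (simp only: M_block mat_adjoint_block_diag[of _ 1] mult_block_diag[of _ 1]
        mat_adjoint_one one_carrier_mat mat_carrier mult_carrier_mat[of _ n n]
        mult_carrier_mat[of _ 1 1] mat_adjoint_carrier)
  also have "\<dots> = real_diag (Suc n) (\<lambda>i. case i of 0 \<Rightarrow> s | Suc k \<Rightarrow> d k)"
    unfolding PDQ by (intro eq_matI) (auto simp: real_diag_def split: nat.splits)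
  finally show ?case
    using s d unitary_mat_mult[OF W(1) P'] unitary_mat_mult[OF V(1) Q']
    by (intro Suc.prems(1)) (auto split: nat.splits)
qed

section \<open>Unitarily invariant norms and diagonals\<close>

lemma norm_phases:
  assumes N: "unitarily_invariant_norm n N" and Y: "Y \<in> carrier_mat n n"
    and u: "\<And>i. cmod (u i) = 1" and v: "\<And>i. cmod (v i) = 1"
  shows "N (mat n n (\<lambda>(i, j). u i * Y $$ (i, j) * v j)) = N Y"
proof -
  define D where "D u = mat n n (\<lambda>(i, j). if i = j then u i else (0::complex))" for u
  have D: "D u \<in> carrier_mat n n" for u
    by (simp add: D_def)
  have unit: "unitary_mat n (D u)" if "\<And>i. cmod (u i) = 1" for u
  proof (rule unitary_matI[OF D])
    have "u i * cnj (u i) = 1" for i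
      using that[of i] by (metis complex_norm_square of_real_1 power_one)
    then show "mat_adjoint (D u) * D u = 1\<^sub>m n"
      by (intro eq_matI) (auto simp: D_def scalar_prod_def if_distrib[of "\<lambda>z. _ * z"]
          if_distrib[of "\<lambda>z. z * _"] if_distrib[of cnj] mult.commute cong: if_cong)
  qed
  have "D u * Y * D v = mat n n (\<lambda>(i, j). u i * Y $$ (i, j) * v j)"
    using Y by (intro eq_matI) (auto simp: D_def scalar_prod_def if_distrib[of "\<lambda>z. _ * z"]
          if_distrib[of "\<lambda>z. z * _"] cong: if_cong)
  then show ?thesis
    using N Y unit[of u] unit[of v] u v by (metis unitarily_invariant_norm_def)
qed

lemma norm_average:
  assumes N: "norm_on_mat n N" and X: "X \<in> carrier_mat n n" "X' \<in> carrier_mat n n"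
    and "N X \<le> r" and "N X' \<le> r"
  shows "N ((1 / 2) \<cdot>\<^sub>m (X + X')) \<le> r"
proof -
  have "N ((1 / 2) \<cdot>\<^sub>m (X + X')) = 1 / 2 * N (X + X')"
    using N X by (simp add: norm_on_mat_def)
  moreover have "N (X + X') \<le> N X + N X'"
    using N X by (simp add: norm_on_mat_def)
  ultimately show ?thesis
    using assms by simp
qed

lemma disk_average_of_circle:
  assumes "cmod c \<le> 1"
  obtains u u' where "cmod u = 1" and "cmod u' = 1" and "c = (u + u') / 2"
proof -
  obtain s where s: "cmod s = 1" "c = of_real (cmod c) * s"
  proof (cases "c = 0")
    case True
    then show ?thesis using that[of 1] by simp
  next
    case False
    then show ?thesis using that[of "c / of_real (cmod c)"] by (simp add: norm_divide)
  qed
  define h where "h = sqrt (1 - (cmod c)\<^sup>2)"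
  have "(cmod c)\<^sup>2 + h\<^sup>2 = 1"
    using assms by (simp add: h_def power_le_one)
  then have "cmod (Complex (cmod c) h) = 1" "cmod (Complex (cmod c) (- h)) = 1"
    by (simp_all add: cmod_def)
  moreover have "c = (s * Complex (cmod c) h + s * Complex (cmod c) (- h)) / 2"
    by (subst s(2)) (simp add: complex_eq_iff)
  ultimately show ?thesis
    using that[of "s * Complex (cmod c) h" "s * Complex (cmod c) (- h)"] s(1)
    by (simp add: norm_mult)
qed

text \<open>
  Changing the sign of row \<open>m\<close> and of column \<open>m\<close> preserves the norm and the diagonal. The average of
  a matrix with its image under this change has no off-diagonal entries left in row and
  column \<open>m\<close>, so all of them disappear after \<open>n\<close> averagings.
\<close>
lemma norm_diagonal_part_le:
  assumes N: "unitarily_invariant_norm n N" and Y: "Y \<in> carrier_mat n n"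
  shows "N (mat n n (\<lambda>(i, j). if i = j then Y $$ (i, j) else 0)) \<le> N Y"
proof -
  \<comment> \<open>\<open>P m\<close> is \<open>Y\<close> after the averagings for the indices below \<open>m\<close>.\<close>
  define P where "P m = mat n n (\<lambda>(i, j). if i = j \<or> (m \<le> i \<and> m \<le> j) then Y $$ (i, j) else 0)" for m
  have P: "P m \<in> carrier_mat n n" for m
    by (simp add: P_def)
  have "N (P m) \<le> N Y" for m
  proof (induction m)
    case 0
    have "P 0 = Y"
      using Y by (intro eq_matI) (auto simp: P_def)
    then show ?case by simp
  next
    case (Suc m)
    define u :: "nat \<Rightarrow> complex" where "u i = (if i = m then - 1 else 1)" for i
    define X where "X = mat n n (\<lambda>(i, j). u i * P m $$ (i, j) * u j)"
    have "N X = N (P m)"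
      unfolding X_def by (rule norm_phases[OF N P]) (auto simp: u_def)
    moreover have "P (Suc m) = (1 / 2) \<cdot>\<^sub>m (P m + X)"
      by (intro eq_matI) (auto simp: P_def X_def u_def)
    ultimately show ?case
      using norm_average[of n N "P m" X "N Y"] N Suc P
      by (simp add: unitarily_invariant_norm_def X_def)
  qed
  moreover have "P n = mat n n (\<lambda>(i, j). if i = j then Y $$ (i, j) else 0)"
    by (intro eq_matI) (auto simp: P_def)
  ultimately show ?thesis
    by metis
qed

text \<open>
  A weak form of monotonicity of the norm. By pinching, it suffices to shrink the diagonal part
  of \<open>Y\<close> to the given diagonal. The shrinking factors lie in the unit disk, so each is an average
  of two unit complex numbers, and a diagonal matrix of unit complex numbers is unitary.
\<close>
lemma norm_real_diag_le:
  assumes N: "unitarily_invariant_norm n N" and Y: "Y \<in> carrier_mat n n"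
    and le: "\<And>i. i < n \<Longrightarrow> \<bar>d i\<bar> \<le> cmod (Y $$ (i, i))"
  shows "N (real_diag n d) \<le> N Y"
proof -
  let ?Y = "mat n n (\<lambda>(i, j). if i = j then Y $$ (i, j) else 0)"
  have "\<exists>u u'. cmod u = 1 \<and> cmod u' = 1 \<and> (i < n \<longrightarrow> of_real (d i) = (u + u') / 2 * Y $$ (i, i))" for i
  proof -
    \<comment> \<open>If \<open>Y $$ (i, i) = 0\<close>, then \<open>d i = 0\<close> too, and the value \<open>c = 0\<close> of the quotient is right.\<close>
    define c where "c = (if i < n then of_real (d i) / Y $$ (i, i) else 0)"
    have "cmod c \<le> 1"
      using le[of i] by (auto simp: c_def norm_divide divide_le_eq_1)
    then obtain u u' where "cmod u = 1" "cmod u' = 1" "c = (u + u') / 2"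
      by (rule disk_average_of_circle)
    moreover have "of_real (d i) = c * Y $$ (i, i)" if "i < n"
      using le[OF that] that by (auto simp: c_def)
    ultimately show ?thesis
      by metis
  qed
  then obtain u u' where u: "\<And>i. cmod (u i) = 1" "\<And>i. cmod (u' i) = 1"
    "\<And>i. i < n \<Longrightarrow> of_real (d i) = (u i + u' i) / 2 * Y $$ (i, i)"
    by metis
  define X where "X u = mat n n (\<lambda>(i, j). u i * ?Y $$ (i, j) * (\<lambda>_. 1) j)" for u
  have "N (X u) = N ?Y" "N (X u') = N ?Y"
    unfolding X_def by (rule norm_phases[OF N]; simp add: u)+
  moreover have "real_diag n d = (1 / 2) \<cdot>\<^sub>m (X u + X u')"
    by (intro eq_matI) (auto simp: real_diag_def X_def u(3) algebra_simps)
  ultimately show ?thesis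
    using norm_average[of n N "X u" "X u'" "N Y"] norm_diagonal_part_le[OF N Y] N
    by (simp add: unitarily_invariant_norm_def X_def)
qed

lemma conj_entry_eq_sesq:
  assumes "T \<in> carrier_mat n n" and "U \<in> carrier_mat n n" and "V \<in> carrier_mat n n"
    and "i < n" and "j < n"
  shows "(mat_adjoint U * T * V) $$ (i, j) = sesq n T (\<lambda>k. U $$ (k, i)) (\<lambda>k. V $$ (k, j))"
proof -
  have UT: "mat_adjoint U * T \<in> carrier_mat n n"
    using assms by auto
  have "(mat_adjoint U * T * V) $$ (i, j) =
      (\<Sum>l<n. (\<Sum>k<n. cnj (U $$ (k, i)) * T $$ (k, l)) * V $$ (l, j))"
    using assms by (simp add: index_mult_mat_sum[OF UT] index_mult_mat_sum[of _ n n T n] del: index_mult_mat)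
  also have "\<dots> = sesq n T (\<lambda>k. U $$ (k, i)) (\<lambda>k. V $$ (k, j))"
    unfolding sesq_def sum_distrib_right by (rule sum.swap)
  finally show ?thesis .
qed

section \<open>The norm inequalities\<close>

text \<open>
  Let \<open>U\<^sup>* T V\<close> be the diagonal matrix of the singular values \<open>d i\<close>. The assumption at the \<open>i\<close>-th
  columns of \<open>U\<close> and \<open>V\<close> bounds \<open>4 d i\<close> by the \<open>i\<close>-th diagonal entry of
  \<open>U\<^sup>* S U + V\<^sup>* S V\<close>. Hence \<open>4 N T \<le> N (U\<^sup>* S U + V\<^sup>* S V) \<le> 2 N S\<close>.
\<close>
lemma norm_le_of_form_le:
  assumes N: "unitarily_invariant_norm n N"
    and T: "T \<in> carrier_mat n n" and S: "S \<in> carrier_mat n n"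
    and form: "\<And>x y. 4 * Re (sesq n T x y) \<le> Re (sesq n S x x) + Re (sesq n S y y)"
  shows "2 * N T \<le> N S"
proof -
  obtain U V d where U: "unitary_mat n U" and V: "unitary_mat n V" and d: "\<And>i. 0 \<le> d i"
    and UTV: "mat_adjoint U * T * V = real_diag n d"
    using singular_value_decomposition[OF T] by blast
  have carr: "U \<in> carrier_mat n n" "V \<in> carrier_mat n n"
    using U V by (auto simp: unitary_mat_def)
  define Y where "Y = mat_adjoint U * S * U + mat_adjoint V * S * V"
  have conj_carr: "mat_adjoint U * S * U \<in> carrier_mat n n" "mat_adjoint V * S * V \<in> carrier_mat n n"
    using carr S by auto
  then have Y: "Y \<in> carrier_mat n n"
    by (simp add: Y_def)
  have le: "4 * d i \<le> Re (Y $$ (i, i))" if i: "i < n" for i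
  proof -
    have "d i = Re ((mat_adjoint U * T * V) $$ (i, i))"
      unfolding UTV using i by (simp add: real_diag_def)
    then have "4 * d i \<le> Re (sesq n S (\<lambda>k. U $$ (k, i)) (\<lambda>k. U $$ (k, i))) +
        Re (sesq n S (\<lambda>k. V $$ (k, i)) (\<lambda>k. V $$ (k, i)))"
      using form conj_entry_eq_sesq[OF T carr i i] by simp
    also have "\<dots> = Re (Y $$ (i, i))"
      using conj_carr i conj_entry_eq_sesq[OF S carr(1) carr(1) i i]
        conj_entry_eq_sesq[OF S carr(2) carr(2) i i]
      by (simp add: Y_def del: index_mult_mat)
    finally show ?thesis .
  qed
  have "N (real_diag n (\<lambda>i. 4 * d i)) \<le> N Y"
  proof (rule norm_real_diag_le[OF N Y])
    fix i assume "i < n"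
    then show "\<bar>4 * d i\<bar> \<le> cmod (Y $$ (i, i))"
      using le[of i] d[of i] complex_Re_le_cmod[of "Y $$ (i, i)"] by simp
  qed
  moreover have "real_diag n (\<lambda>i. 4 * d i) = 4 \<cdot>\<^sub>m real_diag n d"
    by (intro eq_matI) (auto simp: real_diag_def)
  moreover have "N (4 \<cdot>\<^sub>m real_diag n d) = 4 * N (real_diag n d)"
    using N by (simp add: unitarily_invariant_norm_def norm_on_mat_def real_diag_def)
  moreover have "N (real_diag n d) = N T"
    using N U V T unitary_mat_adjoint unfolding UTV[symmetric] unitarily_invariant_norm_def by blast
  moreover have "N Y \<le> N S + N S"
  proof -
    have "N (mat_adjoint U * S * U) = N S" "N (mat_adjoint V * S * V) = N S"
      using N U V S unitary_mat_adjoint unfolding unitarily_invariant_norm_def by blast+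
    then show ?thesis
      using N conj_carr unfolding Y_def unitarily_invariant_norm_def norm_on_mat_def by metis
  qed
  ultimately show ?thesis
    by simp
qed

theorem corollary6p4:
  fixes n :: nat and A B C :: "complex mat" and N :: "complex mat \<Rightarrow> real"
  assumes "n \<ge> 1"
    and "A \<in> carrier_mat n n" and "B \<in> carrier_mat n n" and "C \<in> carrier_mat n n"
    and "psd_mat (2 * n) (four_block_mat A B (mat_adjoint B) C)"
    and "unitarily_invariant_norm n N"
  shows "2 * N (Phi B) \<le> N (Phi A + Phi C) \<and> 2 * N (Psi B) \<le> N (Phi A + Phi C)"
  using assms Phi_Psi_form_le[OF assms(2-5)]
  by (auto intro!: norm_le_of_form_le add_carrier_mat)

end
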